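(* Let $\mathcal{E}$ be an elementary topos that satisfies (NS). If $\mathrm{Dec}(\mathcal{E})$ is reflective in $\mathcal{E}$ (i.e. the inclusion $\mathrm{Dec}(\mathcal{E})\hookrightarrow\mathcal{E}$ has a left adjoint), then $\mathrm{Dec}(\mathcal{E})$ is an exponential ideal of $\mathcal{E}$.
   Context: An object $X$ of a topos $\mathcal{E}$ is decidable if its diagonal $X\rightarrowtail X\times X$ is a complemented subobject. $\mathrm{Dec}(\mathcal{E})$ is the full subcategory of $\mathcal{E}$ on the decidable objects. (NS): any object of $\mathcal{E}$ is either initial or has a global element (an arrow from the terminal object $1$). A full subcategory $\mathcal{D}$ of $\mathcal{E}$ is an exponential ideal if for every object $D$ of $\mathcal{D}$ and every object $X$ of $\mathcal{E}$ the exponential $D^X$ is in $\mathcal{D}$. *)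

theory Defs
  imports "HOL-Algebra.Order"
begin

text \<open>Throughout, \<open>g \<cdot> f\<close> means "first \<open>f\<close>, then \<open>g\<close>". The fields of a category are only meaningful
  on \<open>Ob\<close>, on \<open>Arr\<close>, and on composable pairs; every definition below guards its variables
  accordingly.\<close>

record ('o, 'a) cat =
  Ob :: "'o set"
  Arr :: "'a set"
  Dom :: "'a \<Rightarrow> 'o"
  Cod :: "'a \<Rightarrow> 'o"
  Id :: "'o \<Rightarrow> 'a"
  Comp :: "'a \<Rightarrow> 'a \<Rightarrow> 'a"  (infixl "\<cdot>\<index>" 70)

definition hom_set :: "('o, 'a) cat \<Rightarrow> 'o \<Rightarrow> 'o \<Rightarrow> 'a set" where
  "hom_set C X Y = {f \<in> Arr C. Dom C f = X \<and> Cod C f = Y}"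

locale category =
  fixes C :: "('o, 'a) cat" (structure)
  assumes Dom_in_Ob: "f \<in> Arr C \<Longrightarrow> Dom C f \<in> Ob C"
    and Cod_in_Ob: "f \<in> Arr C \<Longrightarrow> Cod C f \<in> Ob C"
    and Id_in_hom: "X \<in> Ob C \<Longrightarrow> Id C X \<in> hom_set C X X"
    and Comp_in_hom: "\<lbrakk>f \<in> hom_set C X Y; g \<in> hom_set C Y Z\<rbrakk> \<Longrightarrow> g \<cdot> f \<in> hom_set C X Z"
    and Comp_Id: "f \<in> hom_set C X Y \<Longrightarrow> f \<cdot> Id C X = f"
    and Id_Comp: "f \<in> hom_set C X Y \<Longrightarrow> Id C Y \<cdot> f = f"
    and Comp_assoc: "\<lbrakk>f \<in> hom_set C W X; g \<in> hom_set C X Y; h \<in> hom_set C Y Z\<rbrakk>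
        \<Longrightarrow> (h \<cdot> g) \<cdot> f = h \<cdot> (g \<cdot> f)"

definition is_initial :: "('o, 'a) cat \<Rightarrow> 'o \<Rightarrow> bool" where
  "is_initial C X \<longleftrightarrow> X \<in> Ob C \<and> (\<forall>Y \<in> Ob C. \<exists>!f. f \<in> hom_set C X Y)"

definition is_terminal :: "('o, 'a) cat \<Rightarrow> 'o \<Rightarrow> bool" where
  "is_terminal C X \<longleftrightarrow> X \<in> Ob C \<and> (\<forall>Y \<in> Ob C. \<exists>!f. f \<in> hom_set C Y X)"

definition is_mono :: "('o, 'a) cat \<Rightarrow> 'a \<Rightarrow> bool" where
  "is_mono C m \<longleftrightarrow> m \<in> Arr C \<and>
    (\<forall>Z \<in> Ob C. \<forall>f \<in> hom_set C Z (Dom C m). \<forall>g \<in> hom_set C Z (Dom C m).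
      m \<cdot>\<^bsub>C\<^esub> f = m \<cdot>\<^bsub>C\<^esub> g \<longrightarrow> f = g)"

definition is_product :: "('o, 'a) cat \<Rightarrow> 'o \<Rightarrow> 'o \<Rightarrow> 'o \<Rightarrow> 'a \<Rightarrow> 'a \<Rightarrow> bool" where
  "is_product C X Y P p q \<longleftrightarrow>
    X \<in> Ob C \<and> Y \<in> Ob C \<and> P \<in> Ob C \<and> p \<in> hom_set C P X \<and> q \<in> hom_set C P Y \<and>
    (\<forall>Z \<in> Ob C. \<forall>a \<in> hom_set C Z X. \<forall>b \<in> hom_set C Z Y.
      \<exists>!h. h \<in> hom_set C Z P \<and> p \<cdot>\<^bsub>C\<^esub> h = a \<and> q \<cdot>\<^bsub>C\<^esub> h = b)"

definition is_pullback :: "('o, 'a) cat \<Rightarrow> 'a \<Rightarrow> 'a \<Rightarrow> 'o \<Rightarrow> 'a \<Rightarrow> 'a \<Rightarrow> bool" where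
  "is_pullback C f g P p q \<longleftrightarrow>
    f \<in> Arr C \<and> g \<in> Arr C \<and> Cod C f = Cod C g \<and>
    P \<in> Ob C \<and> p \<in> hom_set C P (Dom C f) \<and> q \<in> hom_set C P (Dom C g) \<and>
    f \<cdot>\<^bsub>C\<^esub> p = g \<cdot>\<^bsub>C\<^esub> q \<and>
    (\<forall>Z \<in> Ob C. \<forall>a \<in> hom_set C Z (Dom C f). \<forall>b \<in> hom_set C Z (Dom C g).
      f \<cdot>\<^bsub>C\<^esub> a = g \<cdot>\<^bsub>C\<^esub> b \<longrightarrow>
      (\<exists>!h. h \<in> hom_set C Z P \<and> p \<cdot>\<^bsub>C\<^esub> h = a \<and> q \<cdot>\<^bsub>C\<^esub> h = b))"

text \<open>\<open>is_exponential C X Y P W p q ev\<close>: the object \<open>P\<close> is an exponential \<open>Y\<^sup>X\<close> with evaluation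
  \<open>ev : W \<rightarrow> Y\<close>, where \<open>W\<close>, with projections \<open>p\<close> and \<open>q\<close>, is a product \<open>P \<times> X\<close>. In the universal
  property, \<open>V\<close> is a product \<open>Z \<times> X\<close> and \<open>g\<close> is the arrow \<open>h \<times> X\<close>.\<close>

definition is_exponential ::
    "('o, 'a) cat \<Rightarrow> 'o \<Rightarrow> 'o \<Rightarrow> 'o \<Rightarrow> 'o \<Rightarrow> 'a \<Rightarrow> 'a \<Rightarrow> 'a \<Rightarrow> bool" where
  "is_exponential C X Y P W p q ev \<longleftrightarrow>
    is_product C P X W p q \<and> ev \<in> hom_set C W Y \<and>
    (\<forall>Z V r s f. is_product C Z X V r s \<and> f \<in> hom_set C V Y \<longrightarrow>
      (\<exists>!h. h \<in> hom_set C Z P \<and>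
        (\<exists>g \<in> hom_set C V W. p \<cdot>\<^bsub>C\<^esub> g = h \<cdot>\<^bsub>C\<^esub> r \<and> q \<cdot>\<^bsub>C\<^esub> g = s \<and> ev \<cdot>\<^bsub>C\<^esub> g = f)))"

definition is_subobject_classifier :: "('o, 'a) cat \<Rightarrow> 'a \<Rightarrow> bool" where
  "is_subobject_classifier C t \<longleftrightarrow>
    t \<in> Arr C \<and> is_terminal C (Dom C t) \<and>
    (\<forall>m. is_mono C m \<longrightarrow>
      (\<exists>!\<chi>. \<chi> \<in> hom_set C (Cod C m) (Cod C t) \<and> (\<exists>u. is_pullback C \<chi> t (Dom C m) m u)))"

text \<open>Finite limits are given by a terminal object and pullbacks.\<close>

locale elementary_topos = category +
  assumes terminal: "\<exists>T. is_terminal C T"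
    and pullbacks: "\<lbrakk>f \<in> Arr C; g \<in> Arr C; Cod C f = Cod C g\<rbrakk> \<Longrightarrow> \<exists>P p q. is_pullback C f g P p q"
    and exponentials: "\<lbrakk>X \<in> Ob C; Y \<in> Ob C\<rbrakk> \<Longrightarrow> \<exists>P W p q ev. is_exponential C X Y P W p q ev"
    and subobject_classifier: "\<exists>t. is_subobject_classifier C t"

text \<open>The lattice of subobjects of \<open>X\<close>, presented as the preorder of monomorphisms into \<open>X\<close> under
  factorization; the equivalence relation of the \<open>gorder\<close> identifies monomorphisms that represent
  the same subobject.\<close>

definition factors_through :: "('o, 'a) cat \<Rightarrow> 'a \<Rightarrow> 'a \<Rightarrow> bool" where
  "factors_through C m n \<longleftrightarrow> (\<exists>h \<in> hom_set C (Dom C m) (Dom C n). n \<cdot>\<^bsub>C\<^esub> h = m)"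

definition Sub :: "('o, 'a) cat \<Rightarrow> 'o \<Rightarrow> 'a gorder" where
  "Sub C X =
    \<lparr>carrier = {m. is_mono C m \<and> Cod C m = X},
     eq = (\<lambda>m n. factors_through C m n \<and> factors_through C n m),
     le = factors_through C\<rparr>"

definition complemented_subobject :: "('o, 'a) cat \<Rightarrow> 'o \<Rightarrow> 'a \<Rightarrow> bool" where
  "complemented_subobject C X m \<longleftrightarrow>
    m \<in> carrier (Sub C X) \<and>
    (\<exists>n \<in> carrier (Sub C X).
      (\<exists>b. greatest (Sub C X) b (Lower (Sub C X) {m, n}) \<and> least (Sub C X) b (carrier (Sub C X))) \<and>
      (\<exists>t. least (Sub C X) t (Upper (Sub C X) {m, n}) \<and> greatest (Sub C X) t (carrier (Sub C X))))"

text \<open>Products are only determined up to isomorphism; the condition does not depend on which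
  product \<open>P\<close> of \<open>X\<close> with itself is used.\<close>

definition decidable :: "('o, 'a) cat \<Rightarrow> 'o \<Rightarrow> bool" where
  "decidable C X \<longleftrightarrow> X \<in> Ob C \<and>
    (\<exists>P p q d. is_product C X X P p q \<and>
      d \<in> hom_set C X P \<and> p \<cdot>\<^bsub>C\<^esub> d = Id C X \<and> q \<cdot>\<^bsub>C\<^esub> d = Id C X \<and>
      complemented_subobject C P d)"

definition full_subcategory :: "('o, 'a) cat \<Rightarrow> 'o set \<Rightarrow> ('o, 'a) cat" where
  "full_subcategory C S =
    C\<lparr>Ob := Ob C \<inter> S, Arr := {f \<in> Arr C. Dom C f \<in> S \<and> Cod C f \<in> S}\<rparr>"

definition Dec :: "('o, 'a) cat \<Rightarrow> ('o, 'a) cat" where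
  "Dec C = full_subcategory C {X. decidable C X}"

text \<open>\<open>NS\<close> abbreviates "Nullstellensatz". The disjunction is inclusive; in a topos both
  disjuncts can hold for the same object only if every object is initial.\<close>

definition NS :: "('o, 'a) cat \<Rightarrow> bool" where
  "NS C \<longleftrightarrow> (\<forall>X \<in> Ob C. is_initial C X \<or> (\<exists>T f. is_terminal C T \<and> f \<in> hom_set C T X))"

record ('o, 'a, 'p, 'b) func =
  omap :: "'o \<Rightarrow> 'p"
  amap :: "'a \<Rightarrow> 'b"

definition is_functor :: "('o, 'a) cat \<Rightarrow> ('p, 'b) cat \<Rightarrow> ('o, 'a, 'p, 'b) func \<Rightarrow> bool" where
  "is_functor C D F \<longleftrightarrow>
    (\<forall>X \<in> Ob C. omap F X \<in> Ob D) \<and>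
    (\<forall>X \<in> Ob C. \<forall>Y \<in> Ob C. \<forall>f \<in> hom_set C X Y. amap F f \<in> hom_set D (omap F X) (omap F Y)) \<and>
    (\<forall>X \<in> Ob C. amap F (Id C X) = Id D (omap F X)) \<and>
    (\<forall>X \<in> Ob C. \<forall>Y \<in> Ob C. \<forall>Z \<in> Ob C. \<forall>f \<in> hom_set C X Y. \<forall>g \<in> hom_set C Y Z.
      amap F (g \<cdot>\<^bsub>C\<^esub> f) = amap F g \<cdot>\<^bsub>D\<^esub> amap F f)"

text \<open>\<open>F : C \<rightarrow> D\<close> is left adjoint to \<open>G : D \<rightarrow> C\<close>: there are bijections
  \<open>D(F X, Y) \<cong> C(X, G Y)\<close>, natural in \<open>X\<close> and \<open>Y\<close>.\<close>

definition is_left_adjoint ::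
    "('o, 'a) cat \<Rightarrow> ('p, 'b) cat \<Rightarrow> ('o, 'a, 'p, 'b) func \<Rightarrow> ('p, 'b, 'o, 'a) func \<Rightarrow> bool" where
  "is_left_adjoint C D F G \<longleftrightarrow>
    is_functor C D F \<and> is_functor D C G \<and>
    (\<exists>\<phi>.
      (\<forall>X \<in> Ob C. \<forall>Y \<in> Ob D.
        bij_betw (\<phi> X Y) (hom_set D (omap F X) Y) (hom_set C X (omap G Y))) \<and>
      (\<forall>X \<in> Ob C. \<forall>X' \<in> Ob C. \<forall>Y \<in> Ob D. \<forall>Y' \<in> Ob D.
        \<forall>f \<in> hom_set C X' X. \<forall>g \<in> hom_set D Y Y'. \<forall>h \<in> hom_set D (omap F X) Y.
          \<phi> X' Y' (g \<cdot>\<^bsub>D\<^esub> h \<cdot>\<^bsub>D\<^esub> amap F f) = amap G g \<cdot>\<^bsub>C\<^esub> \<phi> X Y h \<cdot>\<^bsub>C\<^esub> f))"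

definition inclusion :: "('o, 'a, 'o, 'a) func" where
  "inclusion = \<lparr>omap = (\<lambda>X. X), amap = (\<lambda>f. f)\<rparr>"

text \<open>In the next two definitions \<open>D\<close> is meant to be a full subcategory of \<open>C\<close>.\<close>

definition reflective :: "('o, 'a) cat \<Rightarrow> ('o, 'a) cat \<Rightarrow> bool" where
  "reflective C D \<longleftrightarrow> (\<exists>L. is_left_adjoint C D L inclusion)"

text \<open>Every exponential of the given objects is required to lie in \<open>D\<close>, whichever
  representative of its isomorphism class is taken.\<close>

definition exponential_ideal :: "('o, 'a) cat \<Rightarrow> ('o, 'a) cat \<Rightarrow> bool" where
  "exponential_ideal C D \<longleftrightarrow>
    (\<forall>Y \<in> Ob D. \<forall>X \<in> Ob C. \<forall>P W p q ev. is_exponential C X Y P W p q ev \<longrightarrow> P \<in> Ob D)"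

end

theory Submission
  imports Defs
begin

text \<open>Let \<open>P\<close> be an exponential \<open>Y\<^sup>X\<close> with \<open>Y\<close> decidable and let \<open>\<eta> : P \<rightarrow> Q\<close> be its reflection. As a
  subobject of a decidable object is decidable, it suffices that \<open>\<eta>\<close> is monic. If \<open>\<eta> \<cdot> f = \<eta> \<cdot> g\<close> for
  \<open>f, g : Z \<rightarrow> P\<close>, consider the two arrows \<open>Z \<times> X \<rightarrow> Y\<close> corresponding to \<open>f\<close> and \<open>g\<close>. Since \<open>Y\<close> is
  decidable, the part of \<open>Z \<times> X\<close> where they agree is complemented, so by (NS) it is everything as soon
  as they agree at each point \<open>(z, x)\<close>. They do: evaluation at \<open>x\<close> is an arrow \<open>P \<rightarrow> Y\<close>, which factors
  through \<open>\<eta>\<close>, and \<open>\<eta> \<cdot> f \<cdot> z = \<eta> \<cdot> g \<cdot> z\<close>.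

  That complements are stable under pullback follows from the right adjoint \<open>\<forall>\<^sub>f\<close> of the inverse image of
  subobjects along \<open>f\<close>.\<close>

section \<open>Arrows, products, pullbacks and factorization in a category\<close>

context category
begin

lemma hom_Ob:
  assumes "f \<in> hom_set C X Y"
  shows "X \<in> Ob C" "Y \<in> Ob C"
  using assms Dom_in_Ob Cod_in_Ob by (auto simp: hom_set_def)

lemma mono_hom: "is_mono C m \<Longrightarrow> m \<in> hom_set C (Dom C m) (Cod C m)"
  by (simp add: is_mono_def hom_set_def)

lemma mono_cancel:
  assumes "is_mono C m" "m \<in> hom_set C M B" "f \<in> hom_set C Z M" "g \<in> hom_set C Z M" "m \<cdot> f = m \<cdot> g"
  shows "f = g"
  using assms hom_Ob(1)[OF assms(3)] by (auto simp: is_mono_def hom_set_def)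

lemma monoI:
  assumes "m \<in> hom_set C M B"
    and "\<And>Z f g. \<lbrakk>f \<in> hom_set C Z M; g \<in> hom_set C Z M; m \<cdot> f = m \<cdot> g\<rbrakk> \<Longrightarrow> f = g"
  shows "is_mono C m"
  using assms by (auto simp: is_mono_def hom_set_def)

lemma mono_Id: "X \<in> Ob C \<Longrightarrow> is_mono C (Id C X)"
  by (rule monoI[OF Id_in_hom]) (auto simp: Id_Comp)

lemma mono_comp:
  assumes "is_mono C m" "m \<in> hom_set C M B" "is_mono C n" "n \<in> hom_set C N M"
  shows "is_mono C (m \<cdot> n)"
proof (rule monoI[OF Comp_in_hom[OF assms(4,2)]])
  fix Z f g assume fg: "f \<in> hom_set C Z N" "g \<in> hom_set C Z N" "m \<cdot> n \<cdot> f = m \<cdot> n \<cdot> g"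
  then have "m \<cdot> (n \<cdot> f) = m \<cdot> (n \<cdot> g)"
    using Comp_assoc[OF _ assms(4,2)] fg by simp
  then have "n \<cdot> f = n \<cdot> g"
    using mono_cancel[OF assms(1,2) Comp_in_hom[OF fg(1) assms(4)] Comp_in_hom[OF fg(2) assms(4)]] by blast
  then show "f = g"
    using mono_cancel[OF assms(3,4)] fg(1,2) by blast
qed

lemma split_mono:
  assumes "m \<in> hom_set C M B" "r \<in> hom_set C B M" "r \<cdot> m = Id C M"
  shows "is_mono C m"
proof (rule monoI[OF assms(1)])
  fix Z f g assume fg: "f \<in> hom_set C Z M" "g \<in> hom_set C Z M" "m \<cdot> f = m \<cdot> g"
  have "r \<cdot> m \<cdot> f = r \<cdot> m \<cdot> g"
    using Comp_assoc[OF fg(1) assms(1,2)] Comp_assoc[OF fg(2) assms(1,2)] fg(3) by simp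
  then show "f = g"
    using fg Id_Comp assms(3) by metis
qed

lemma terminal_hom:
  assumes "is_terminal C T" "X \<in> Ob C"
  obtains f where "f \<in> hom_set C X T"
  using assms unfolding is_terminal_def by blast

lemma terminal_ext:
  assumes "is_terminal C T" "f \<in> hom_set C X T" "g \<in> hom_set C X T"
  shows "f = g"
  using assms hom_Ob(1)[OF assms(2)] unfolding is_terminal_def by blast

lemma terminal_mono:
  assumes "is_terminal C T" "c \<in> hom_set C T X"
  shows "is_mono C c"
  using assms by (intro monoI[OF assms(2)]) (auto intro: terminal_ext)

lemma product_hom:
  assumes "is_product C X Y P p q"
  shows "p \<in> hom_set C P X" "q \<in> hom_set C P Y"
  using assms by (auto simp: is_product_def)

lemma product_pair:
  assumes "is_product C X Y P p q" "a \<in> hom_set C Z X" "b \<in> hom_set C Z Y"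
  obtains h where "h \<in> hom_set C Z P" "p \<cdot> h = a" "q \<cdot> h = b"
  using assms hom_Ob(1)[OF assms(2)] unfolding is_product_def by blast

lemma product_ext:
  assumes P: "is_product C X Y P p q" and h: "h \<in> hom_set C Z P" and k: "k \<in> hom_set C Z P"
    and eq: "p \<cdot> h = p \<cdot> k" "q \<cdot> h = q \<cdot> k"
  shows "h = k"
proof -
  have "p \<cdot> k \<in> hom_set C Z X" "q \<cdot> k \<in> hom_set C Z Y"
    using Comp_in_hom[OF k] product_hom[OF P] by auto
  then have "\<exists>!h. h \<in> hom_set C Z P \<and> p \<cdot> h = p \<cdot> k \<and> q \<cdot> h = q \<cdot> k"
    using P hom_Ob(1)[OF h] unfolding is_product_def by blast
  then show ?thesis
    using h k eq by blast
qed

lemma pullback_hom: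
  assumes "is_pullback C f g P p q" "f \<in> hom_set C A B" "g \<in> hom_set C A' B"
  shows "p \<in> hom_set C P A" "q \<in> hom_set C P A'" "f \<cdot> p = g \<cdot> q"
  using assms by (auto simp: is_pullback_def hom_set_def)

lemma pullbackI:
  assumes f: "f \<in> hom_set C A B" and g: "g \<in> hom_set C A' B"
    and p: "p \<in> hom_set C P A" and q: "q \<in> hom_set C P A'" and eq: "f \<cdot> p = g \<cdot> q"
    and universal: "\<And>Z a b. \<lbrakk>a \<in> hom_set C Z A; b \<in> hom_set C Z A'; f \<cdot> a = g \<cdot> b\<rbrakk> \<Longrightarrow>
      \<exists>!h. h \<in> hom_set C Z P \<and> p \<cdot> h = a \<and> q \<cdot> h = b"
  shows "is_pullback C f g P p q"
proof -
  have "Dom C f = A" "Dom C g = A'" "f \<in> Arr C" "g \<in> Arr C" "Cod C f = Cod C g"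
    using f g by (auto simp: hom_set_def)
  then show ?thesis
    unfolding is_pullback_def using p q eq universal hom_Ob(1)[OF p] by simp
qed

lemma pullback_pair:
  assumes "is_pullback C f g P p q" "f \<in> hom_set C A B" "g \<in> hom_set C A' B"
    and "a \<in> hom_set C Z A" "b \<in> hom_set C Z A'" "f \<cdot> a = g \<cdot> b"
  obtains h where "h \<in> hom_set C Z P" "p \<cdot> h = a" "q \<cdot> h = b"
proof -
  have "Dom C f = A" "Dom C g = A'"
    using assms(2,3) by (auto simp: hom_set_def)
  then show ?thesis
    using assms hom_Ob(1)[OF assms(4)] that unfolding is_pullback_def by blast
qed

lemma pullback_ext:
  assumes P: "is_pullback C f g P p q" "f \<in> hom_set C A B" "g \<in> hom_set C A' B"
    and h: "h \<in> hom_set C Z P" and k: "k \<in> hom_set C Z P" and eq: "p \<cdot> h = p \<cdot> k" "q \<cdot> h = q \<cdot> k"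
  shows "h = k"
proof -
  note pq = pullback_hom[OF P]
  have "p \<cdot> k \<in> hom_set C Z A" "q \<cdot> k \<in> hom_set C Z A'"
    using Comp_in_hom[OF k] pq by auto
  moreover have "f \<cdot> (p \<cdot> k) = g \<cdot> (q \<cdot> k)"
    using Comp_assoc[OF k pq(1) P(2)] Comp_assoc[OF k pq(2) P(3)] pq(3) by simp
  moreover have "Dom C f = A" "Dom C g = A'"
    using P(2,3) by (auto simp: hom_set_def)
  ultimately have "\<exists>!h. h \<in> hom_set C Z P \<and> p \<cdot> h = p \<cdot> k \<and> q \<cdot> h = q \<cdot> k"
    using P(1) hom_Ob(1)[OF h] unfolding is_pullback_def by blast
  then show ?thesis
    using h k eq by blast
qed

lemma factors_throughI:
  assumes "h \<in> hom_set C Z M" "c \<in> hom_set C Z B" "m \<in> hom_set C M B" "m \<cdot> h = c"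
  shows "factors_through C c m"
  using assms by (auto simp: factors_through_def hom_set_def)

lemma factors_throughE:
  assumes "factors_through C c m" "c \<in> hom_set C Z B" "m \<in> hom_set C M B"
  obtains h where "h \<in> hom_set C Z M" "m \<cdot> h = c"
  using assms by (auto simp: factors_through_def hom_set_def)

lemma factors_through_comp:
  assumes "factors_through C c m" "c \<in> hom_set C Z B" "m \<in> hom_set C M B" "k \<in> hom_set C Y Z"
  shows "factors_through C (c \<cdot> k) m"
proof -
  obtain h where h: "h \<in> hom_set C Z M" "m \<cdot> h = c"
    using factors_throughE assms(1-3) by blast
  show ?thesis
    by (rule factors_throughI[OF Comp_in_hom[OF assms(4) h(1)] Comp_in_hom[OF assms(4,2)] assms(3)])
       (use Comp_assoc[OF assms(4) h(1) assms(3)] h(2) in simp)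
qed

lemma factors_through_trans:
  assumes "factors_through C c m" "factors_through C m n"
    and "c \<in> hom_set C Z B" "m \<in> hom_set C M B" "n \<in> hom_set C N B"
  shows "factors_through C c n"
proof -
  obtain h where "h \<in> hom_set C Z M" "m \<cdot> h = c"
    using factors_throughE assms by blast
  then show ?thesis
    using factors_through_comp[OF assms(2,4,5)] by blast
qed

lemma pullback_of_mono:
  assumes P: "is_pullback C f m P p q" "f \<in> hom_set C A B" "m \<in> hom_set C M B" and m: "is_mono C m"
  shows "is_mono C p"
proof (rule monoI)
  note pq = pullback_hom[OF P]
  show "p \<in> hom_set C P A" by (rule pq(1))
  fix Z h k assume hk: "h \<in> hom_set C Z P" "k \<in> hom_set C Z P" "p \<cdot> h = p \<cdot> k"
  have "m \<cdot> (q \<cdot> h) = m \<cdot> (q \<cdot> k)"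
    using Comp_assoc[OF hk(1) pq(1) P(2)] Comp_assoc[OF hk(1) pq(2) P(3)]
      Comp_assoc[OF hk(2) pq(1) P(2)] Comp_assoc[OF hk(2) pq(2) P(3)] pq(3) hk(3) by simp
  then have "q \<cdot> h = q \<cdot> k"
    using mono_cancel[OF m P(3) Comp_in_hom[OF hk(1) pq(2)] Comp_in_hom[OF hk(2) pq(2)]] by blast
  then show "h = k"
    using pullback_ext[OF P] hk by blast
qed

text \<open>With arrows into \<open>A\<close> read as generalized elements, the universal property
  makes \<open>p\<close> the inverse image of \<open>m\<close> along \<open>f\<close>. Subobjects
  are handled below through such membership statements.\<close>

lemma pullback_factors_through_iff:
  assumes P: "is_pullback C f m P p q" "f \<in> hom_set C A B" "m \<in> hom_set C M B"
    and c: "c \<in> hom_set C Z A"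
  shows "factors_through C c p \<longleftrightarrow> factors_through C (f \<cdot> c) m"
proof
  note pq = pullback_hom[OF P]
  note fc = Comp_in_hom[OF c P(2)]
  show "factors_through C (f \<cdot> c) m" if ft: "factors_through C c p"
  proof -
    obtain h where h: "h \<in> hom_set C Z P" "p \<cdot> h = c"
      using factors_throughE[OF ft c pq(1)] by blast
    have "m \<cdot> (q \<cdot> h) = f \<cdot> c"
      using Comp_assoc[OF h(1) pq(1) P(2)] Comp_assoc[OF h(1) pq(2) P(3)] pq(3) h(2) by simp
    then show ?thesis
      using factors_throughI[OF Comp_in_hom[OF h(1) pq(2)] fc P(3)] by blast
  qed
  show "factors_through C c p" if ft: "factors_through C (f \<cdot> c) m"
  proof -
    obtain h where h: "h \<in> hom_set C Z M" "m \<cdot> h = f \<cdot> c"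
      using factors_throughE[OF ft fc P(3)] by blast
    then show ?thesis
      using pullback_pair[OF P c h(1) h(2)[symmetric]] factors_throughI[OF _ c pq(1)] by blast
  qed
qed

end

section \<open>Products, equalizers and characteristic arrows in a topos\<close>

context elementary_topos
begin

lemma pullback_ex:
  assumes "f \<in> hom_set C A B" "g \<in> hom_set C A' B"
  obtains P p q where "is_pullback C f g P p q"
  using assms pullbacks[of f g] by (auto simp: hom_set_def)

text \<open>A pullback over a terminal object is a product, because parallel arrows into a terminal
  object agree.\<close>

lemma product_ex:
  assumes "X \<in> Ob C" "Y \<in> Ob C"
  obtains P p q where "is_product C X Y P p q"
proof -
  obtain T where T: "is_terminal C T" using terminal by blast
  obtain f g where f: "f \<in> hom_set C X T" and g: "g \<in> hom_set C Y T"
    using terminal_hom T assms by metis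
  obtain P p q where P: "is_pullback C f g P p q"
    using pullback_ex f g by blast
  note pq = pullback_hom[OF P f g]
  have "\<exists>!h. h \<in> hom_set C Z P \<and> p \<cdot> h = a \<and> q \<cdot> h = b"
    if "a \<in> hom_set C Z X" "b \<in> hom_set C Z Y" for Z a b
  proof -
    have "f \<cdot> a = g \<cdot> b"
      using terminal_ext[OF T Comp_in_hom[OF that(1) f] Comp_in_hom[OF that(2) g]] .
    then show ?thesis
      using pullback_pair[OF P f g that] pullback_ext[OF P f g] by metis
  qed
  then have "is_product C X Y P p q"
    using assms pq hom_Ob(1)[OF pq(1)] by (simp add: is_product_def)
  then show ?thesis using that by blast
qed

text \<open>The equalizer is the intersection of the graphs \<open>u\<close> and \<open>v\<close> of
  \<open>h\<close> and \<open>k\<close> in \<open>B \<times> Y\<close>, obtained by pulling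
  \<open>v\<close> back along \<open>u\<close>.\<close>

lemma equalizer_ex:
  assumes h: "h \<in> hom_set C B Y" and k: "k \<in> hom_set C B Y"
  obtains e where "is_mono C e" "Cod C e = B"
    "\<And>T t. t \<in> hom_set C T B \<Longrightarrow> factors_through C t e \<longleftrightarrow> h \<cdot> t = k \<cdot> t"
proof -
  note B = hom_Ob[OF h]
  note I = Id_in_hom[OF B(1)]
  obtain Q r s where Q: "is_product C B Y Q r s"
    using product_ex B by blast
  note rs = product_hom[OF Q]
  obtain u where u: "u \<in> hom_set C B Q" "r \<cdot> u = Id C B" "s \<cdot> u = h"
    using product_pair[OF Q I h] by blast
  obtain v where v: "v \<in> hom_set C B Q" "r \<cdot> v = Id C B" "s \<cdot> v = k"
    using product_pair[OF Q I k] by blast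
  have comps: "r \<cdot> (u \<cdot> t) = t" "s \<cdot> (u \<cdot> t) = h \<cdot> t" "r \<cdot> (v \<cdot> t) = t" "s \<cdot> (v \<cdot> t) = k \<cdot> t"
    if "t \<in> hom_set C T B" for T t
    using Comp_assoc[OF that u(1) rs(1)] Comp_assoc[OF that u(1) rs(2)]
      Comp_assoc[OF that v(1) rs(1)] Comp_assoc[OF that v(1) rs(2)] Id_Comp[OF that] u v by auto
  obtain E e e' where E: "is_pullback C u v E e e'"
    using pullback_ex u(1) v(1) by blast
  note e = pullback_hom[OF E u(1) v(1)]
  \<comment> \<open>The graph \<open>v\<close> is split by the projection \<open>r\<close>, so it is
    monic, and so is its pullback \<open>e\<close>.\<close>
  have "is_mono C e"
    using pullback_of_mono[OF E u(1) v(1)] split_mono v(1,2) rs(1) by blast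
  moreover have "Cod C e = B"
    using e(1) by (simp add: hom_set_def)
  moreover have "factors_through C t e \<longleftrightarrow> h \<cdot> t = k \<cdot> t" if t: "t \<in> hom_set C T B" for T t
  proof -
    note ut = Comp_in_hom[OF t u(1)] and vt = Comp_in_hom[OF t v(1)]
    have "factors_through C (u \<cdot> t) v \<longleftrightarrow> h \<cdot> t = k \<cdot> t"
    proof
      assume "factors_through C (u \<cdot> t) v"
      then obtain x where x: "x \<in> hom_set C T B" "v \<cdot> x = u \<cdot> t"
        using factors_throughE ut v(1) by metis
      \<comment> \<open>The projection \<open>r\<close> undoes both graphs.\<close>
      then have "x = t"
        using comps t by metis
      then show "h \<cdot> t = k \<cdot> t"
        using x comps t by metis
    next
      assume "h \<cdot> t = k \<cdot> t"
      then have "u \<cdot> t = v \<cdot> t"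
        using product_ext[OF Q ut vt] comps[OF t] by simp
      then show "factors_through C (u \<cdot> t) v"
        using factors_throughI[OF t ut v(1)] by simp
    qed
    then show ?thesis
      using pullback_factors_through_iff[OF E u(1) v(1) t] by blast
  qed
  ultimately show ?thesis using that by blast
qed

text \<open>Both arrows pull \<open>t\<close> back to the same subobject \<open>p\<close> of
  \<open>V\<close>, so uniqueness of characteristic arrows identifies them.\<close>

lemma classifier_ext:
  assumes t: "is_subobject_classifier C t"
    and a: "a \<in> hom_set C V (Cod C t)" and b: "b \<in> hom_set C V (Cod C t)"
    and iff: "\<And>Z c. c \<in> hom_set C Z V \<Longrightarrow> factors_through C (a \<cdot> c) t \<longleftrightarrow> factors_through C (b \<cdot> c) t"
  shows "a = b"
proof -
  have tm: "t \<in> hom_set C (Dom C t) (Cod C t)"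
    using t by (auto simp: is_subobject_classifier_def hom_set_def)
  have T: "is_terminal C (Dom C t)"
    using t by (auto simp: is_subobject_classifier_def)
  have mt: "is_mono C t"
    using terminal_mono[OF T tm] .
  obtain P p q where P: "is_pullback C a t P p q"
    using pullback_ex a tm by blast
  note pq = pullback_hom[OF P a tm]
  have mp: "is_mono C p"
    using pullback_of_mono[OF P a tm mt] .
  have Dp: "Dom C p = P" "Cod C p = V"
    using pq(1) by (auto simp: hom_set_def)
  have iff': "factors_through C c p \<longleftrightarrow> factors_through C (b \<cdot> c) t" if "c \<in> hom_set C Z V" for Z c
    using iff[OF that] pullback_factors_through_iff[OF P a tm that] by blast
  have "factors_through C p p"
    using factors_throughI[OF Id_in_hom[OF hom_Ob(1)[OF pq(1)]] pq(1) pq(1)] Comp_Id[OF pq(1)] by blast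
  then have "factors_through C (b \<cdot> p) t"
    using iff' pq(1) by blast
  then obtain x where "x \<in> hom_set C P (Dom C t)" "t \<cdot> x = b \<cdot> p"
    using factors_throughE[OF _ Comp_in_hom[OF pq(1) b] tm] by blast
  \<comment> \<open>The factor \<open>x\<close> ends in a terminal object, so it equals
    \<open>q\<close>.\<close>
  then have bq: "b \<cdot> p = t \<cdot> q"
    using terminal_ext[OF T _ pq(2)] by metis
  have "\<exists>!h. h \<in> hom_set C Z P \<and> p \<cdot> h = c \<and> q \<cdot> h = d"
    if c: "c \<in> hom_set C Z V" and d: "d \<in> hom_set C Z (Dom C t)" and eq: "b \<cdot> c = t \<cdot> d" for Z c d
  proof -
    have "factors_through C c p"
      using iff'[OF c] factors_throughI[OF d Comp_in_hom[OF c b] tm] eq by simp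
    then obtain h where h: "h \<in> hom_set C Z P" "p \<cdot> h = c"
      using factors_throughE[OF _ c pq(1)] by blast
    moreover have "q \<cdot> h = d"
      using terminal_ext[OF T Comp_in_hom[OF h(1) pq(2)] d] .
    ultimately show ?thesis
      using mono_cancel[OF mp pq(1)] by metis
  qed
  then have "is_pullback C b t P p q"
    by (rule pullbackI[OF b tm pq(1,2) bq])
  moreover have "\<exists>!\<chi>. \<chi> \<in> hom_set C V (Cod C t) \<and> (\<exists>u. is_pullback C \<chi> t P p u)"
    using t mp Dp unfolding is_subobject_classifier_def by metis
  ultimately show ?thesis
    using a b P by blast
qed

text \<open>The classifying square is a pullback, so \<open>\<chi>\<close> turns membership in
  \<open>m\<close> into truth. Together with \<open>classifier_ext\<close> this reduces comparing
  subobjects to comparing arrows.\<close>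

lemma characteristic_arrow:
  assumes t: "is_subobject_classifier C t" and m: "is_mono C m" "m \<in> hom_set C M B"
  obtains \<chi> where "\<chi> \<in> hom_set C B (Cod C t)"
    "\<And>Z c. c \<in> hom_set C Z B \<Longrightarrow> factors_through C (\<chi> \<cdot> c) t \<longleftrightarrow> factors_through C c m"
proof -
  have tm: "t \<in> hom_set C (Dom C t) (Cod C t)"
    using t by (auto simp: is_subobject_classifier_def hom_set_def)
  obtain \<chi> u where \<chi>: "\<chi> \<in> hom_set C B (Cod C t)" "is_pullback C \<chi> t M m u"
    using t m unfolding is_subobject_classifier_def hom_set_def by blast
  then show ?thesis
    using that pullback_factors_through_iff[OF \<chi>(2,1) tm] by blast
qed

section \<open>Universal quantification along an arrow\<close>

text \<open>The arrow \<open>e\<close> below is the equalizer of the transposes of \<open>a\<close> and \<open>b\<close>.\<close>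

lemma universal_equalizer:
  assumes V: "is_product C B A V p q" and a: "a \<in> hom_set C V Y" and b: "b \<in> hom_set C V Y"
  obtains e where "is_mono C e" "Cod C e = B"
    "\<And>T VT r s j t. \<lbrakk>is_product C T A VT r s; t \<in> hom_set C T B; j \<in> hom_set C VT V;
        p \<cdot> j = t \<cdot> r; q \<cdot> j = s\<rbrakk> \<Longrightarrow> factors_through C t e \<longleftrightarrow> a \<cdot> j = b \<cdot> j"
proof -
  note pq = product_hom[OF V]
  note Y = hom_Ob(2)[OF a] and A = hom_Ob(2)[OF pq(2)]
  obtain P W pW qW ev where X: "is_exponential C A Y P W pW qW ev"
    using exponentials A Y by blast
  have W: "is_product C P A W pW qW" and ev: "ev \<in> hom_set C W Y"
    using X by (auto simp: is_exponential_def)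
  note pqW = product_hom[OF W]
  have transpose: "\<exists>!h. h \<in> hom_set C Z P \<and>
      (\<exists>g \<in> hom_set C V' W. pW \<cdot> g = h \<cdot> r \<and> qW \<cdot> g = s \<and> ev \<cdot> g = f)"
    if "is_product C Z A V' r s" "f \<in> hom_set C V' Y" for Z V' r s f
    using X that unfolding is_exponential_def by blast
  obtain h g where h: "h \<in> hom_set C B P"
    and g: "g \<in> hom_set C V W" "pW \<cdot> g = h \<cdot> p" "qW \<cdot> g = q" "ev \<cdot> g = a"
    using transpose[OF V a] by blast
  obtain h' g' where h': "h' \<in> hom_set C B P"
    and g': "g' \<in> hom_set C V W" "pW \<cdot> g' = h' \<cdot> p" "qW \<cdot> g' = q" "ev \<cdot> g' = b"
    using transpose[OF V b] by blast
  \<comment> \<open>Internally, \<open>e\<close> consists of the elements of \<open>B\<close> over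
    which \<open>a\<close> and \<open>b\<close> agree on all of \<open>A\<close>.\<close>
  obtain e where e: "is_mono C e" "Cod C e = B"
    and eq: "\<And>T t. t \<in> hom_set C T B \<Longrightarrow> factors_through C t e \<longleftrightarrow> h \<cdot> t = h' \<cdot> t"
    using equalizer_ex[OF h h'] by blast
  have "factors_through C t e \<longleftrightarrow> a \<cdot> j = b \<cdot> j"
    if VT: "is_product C T A VT r s" and t: "t \<in> hom_set C T B" and j: "j \<in> hom_set C VT V"
      and pj: "p \<cdot> j = t \<cdot> r" and qj: "q \<cdot> j = s" for T VT r s j t
  proof -
    note rs = product_hom[OF VT]
    note gj = Comp_in_hom[OF j g(1)] and gj' = Comp_in_hom[OF j g'(1)]
    \<comment> \<open>As \<open>j\<close> is \<open>t \<times> A\<close>, the arrow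
      \<open>g \<cdot> j\<close> exhibits \<open>h \<cdot> t\<close> as the transpose of
      \<open>a \<cdot> j\<close>; likewise \<open>h' \<cdot> t\<close> is the transpose of
      \<open>b \<cdot> j\<close>. Hence one pair is equal exactly when the other is.\<close>
    have gjp: "pW \<cdot> (g \<cdot> j) = (h \<cdot> t) \<cdot> r" "qW \<cdot> (g \<cdot> j) = s" "ev \<cdot> (g \<cdot> j) = a \<cdot> j"
      using Comp_assoc[OF j g(1) pqW(1)] Comp_assoc[OF j g(1) pqW(2)] Comp_assoc[OF j g(1) ev] g(2-4)
        Comp_assoc[OF j pq(1) h] Comp_assoc[OF rs(1) t h] pj qj by simp_all
    have gjp': "pW \<cdot> (g' \<cdot> j) = (h' \<cdot> t) \<cdot> r" "qW \<cdot> (g' \<cdot> j) = s" "ev \<cdot> (g' \<cdot> j) = b \<cdot> j"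
      using Comp_assoc[OF j g'(1) pqW(1)] Comp_assoc[OF j g'(1) pqW(2)] Comp_assoc[OF j g'(1) ev] g'(2-4)
        Comp_assoc[OF j pq(1) h'] Comp_assoc[OF rs(1) t h'] pj qj by simp_all
    have "h \<cdot> t = h' \<cdot> t \<longleftrightarrow> a \<cdot> j = b \<cdot> j"
    proof
      assume "h \<cdot> t = h' \<cdot> t"
      then have "g \<cdot> j = g' \<cdot> j"
        using product_ext[OF W gj gj'] gjp gjp' by simp
      then show "a \<cdot> j = b \<cdot> j"
        using gjp(3) gjp'(3) by simp
    next
      assume "a \<cdot> j = b \<cdot> j"
      then show "h \<cdot> t = h' \<cdot> t"
        using transpose[OF VT Comp_in_hom[OF j a]] gj gj' gjp gjp'
          Comp_in_hom[OF t h] Comp_in_hom[OF t h'] by metis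
    qed
    then show ?thesis
      using eq[OF t] by blast
  qed
  then show ?thesis
    using that e by blast
qed

text \<open>Internally \<open>e\<close> is \<open>{b. \<forall>a. f a = b \<longrightarrow> a \<in> s}\<close>: compare, over \<open>B\<close>, the characteristic
  arrows on \<open>B \<times> A\<close> of the graph of \<open>f\<close> and of its restriction to \<open>s\<close>.\<close>

lemma universal_image:
  assumes f: "f \<in> hom_set C A B" and s: "is_mono C s" "s \<in> hom_set C S A"
  obtains e where "is_mono C e" "Cod C e = B"
    "\<And>T t. t \<in> hom_set C T B \<Longrightarrow> factors_through C t e \<longleftrightarrow>
      (\<forall>Z. \<forall>u \<in> hom_set C Z T. \<forall>v \<in> hom_set C Z A. f \<cdot> v = t \<cdot> u \<longrightarrow> factors_through C v s)"
proof -
  note AB = hom_Ob[OF f]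
  note I = Id_in_hom[OF AB(1)]
  obtain V p q where V: "is_product C B A V p q"
    using product_ex AB by blast
  note pq = product_hom[OF V]
  \<comment> \<open>\<open>\<gamma>\<close> embeds the graph of \<open>f\<close> in
    \<open>B \<times> A\<close>, and \<open>\<gamma> \<cdot> s\<close> is its restriction to
    \<open>s\<close>.\<close>
  obtain \<gamma> where \<gamma>: "\<gamma> \<in> hom_set C A V" "p \<cdot> \<gamma> = f" "q \<cdot> \<gamma> = Id C A"
    using product_pair[OF V f I] by blast
  have m\<gamma>: "is_mono C \<gamma>"
    using split_mono[OF \<gamma>(1) pq(2) \<gamma>(3)] .
  note \<gamma>s = Comp_in_hom[OF s(2) \<gamma>(1)]
  have m\<gamma>s: "is_mono C (\<gamma> \<cdot> s)"
    using mono_comp[OF m\<gamma> \<gamma>(1) s] .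
  have \<gamma>v: "p \<cdot> (\<gamma> \<cdot> v) = f \<cdot> v" "q \<cdot> (\<gamma> \<cdot> v) = v" if "v \<in> hom_set C Z A" for Z v
    using Comp_assoc[OF that \<gamma>(1) pq(1)] Comp_assoc[OF that \<gamma>(1) pq(2)] \<gamma> Id_Comp[OF that] by simp_all
  have ft\<gamma>s: "factors_through C (\<gamma> \<cdot> v) (\<gamma> \<cdot> s) \<longleftrightarrow> factors_through C v s" if v: "v \<in> hom_set C Z A" for Z v
  proof
    assume "factors_through C (\<gamma> \<cdot> v) (\<gamma> \<cdot> s)"
    then obtain x where x: "x \<in> hom_set C Z S" "\<gamma> \<cdot> s \<cdot> x = \<gamma> \<cdot> v"
      using factors_throughE Comp_in_hom[OF v \<gamma>(1)] \<gamma>s by metis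
    then have "s \<cdot> x = v"
      using Comp_assoc[OF x(1) s(2) \<gamma>(1)] mono_cancel[OF m\<gamma> \<gamma>(1) Comp_in_hom[OF x(1) s(2)] v] by simp
    then show "factors_through C v s"
      using factors_throughI[OF x(1) v s(2)] by blast
  next
    assume "factors_through C v s"
    then obtain x where x: "x \<in> hom_set C Z S" "s \<cdot> x = v"
      using factors_throughE v s(2) by metis
    then show "factors_through C (\<gamma> \<cdot> v) (\<gamma> \<cdot> s)"
      using factors_throughI[OF x(1) Comp_in_hom[OF v \<gamma>(1)] \<gamma>s] Comp_assoc[OF x(1) s(2) \<gamma>(1)] by simp
  qed
  obtain \<tau> where \<tau>: "is_subobject_classifier C \<tau>"
    using subobject_classifier by blast
  obtain a where a: "a \<in> hom_set C V (Cod C \<tau>)"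
    and aiff: "\<And>Z c. c \<in> hom_set C Z V \<Longrightarrow> factors_through C (a \<cdot> c) \<tau> \<longleftrightarrow> factors_through C c \<gamma>"
    using characteristic_arrow[OF \<tau> m\<gamma> \<gamma>(1)] by blast
  obtain b where b: "b \<in> hom_set C V (Cod C \<tau>)"
    and biff: "\<And>Z c. c \<in> hom_set C Z V \<Longrightarrow> factors_through C (b \<cdot> c) \<tau> \<longleftrightarrow> factors_through C c (\<gamma> \<cdot> s)"
    using characteristic_arrow[OF \<tau> m\<gamma>s \<gamma>s] by blast
  obtain e where e: "is_mono C e" "Cod C e = B"
    and eiff: "\<And>T VT r k j t. \<lbrakk>is_product C T A VT r k; t \<in> hom_set C T B; j \<in> hom_set C VT V;
        p \<cdot> j = t \<cdot> r; q \<cdot> j = k\<rbrakk> \<Longrightarrow> factors_through C t e \<longleftrightarrow> a \<cdot> j = b \<cdot> j"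
    using universal_equalizer[OF V a b] by blast
  have "factors_through C t e \<longleftrightarrow>
      (\<forall>Z. \<forall>u \<in> hom_set C Z T. \<forall>v \<in> hom_set C Z A. f \<cdot> v = t \<cdot> u \<longrightarrow> factors_through C v s)"
    (is "_ \<longleftrightarrow> ?R") if t: "t \<in> hom_set C T B" for T t
  proof -
    obtain VT r k where VT: "is_product C T A VT r k"
      using product_ex hom_Ob(1)[OF t] AB(1) by blast
    note rk = product_hom[OF VT]
    obtain j where j: "j \<in> hom_set C VT V" "p \<cdot> j = t \<cdot> r" "q \<cdot> j = k"
      using product_pair[OF V Comp_in_hom[OF rk(1) t] rk(2)] by blast
    have jc: "p \<cdot> (j \<cdot> c) = t \<cdot> (r \<cdot> c)" "q \<cdot> (j \<cdot> c) = k \<cdot> c" if "c \<in> hom_set C Z VT" for Z c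
      using Comp_assoc[OF that j(1) pq(1)] Comp_assoc[OF that j(1) pq(2)] j
        Comp_assoc[OF that rk(1) t] by simp_all
    \<comment> \<open>An element \<open>c\<close> of \<open>T \<times> A\<close> is a pair of some
      \<open>u\<close> and \<open>v\<close>, and \<open>j \<cdot> c\<close> lies on the graph
      exactly when \<open>f \<cdot> v = t \<cdot> u\<close>. The characteristic arrows
      \<open>a\<close> and \<open>b\<close> agree along \<open>j\<close> exactly when every such
      \<open>v\<close> lies in \<open>s\<close>.\<close>
    have "a \<cdot> j = b \<cdot> j \<longleftrightarrow> ?R"
    proof
      assume eq: "a \<cdot> j = b \<cdot> j"
      show ?R
      proof (intro allI ballI impI)
        fix Z u v assume u: "u \<in> hom_set C Z T" and v: "v \<in> hom_set C Z A" and fv: "f \<cdot> v = t \<cdot> u"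
        obtain c where c: "c \<in> hom_set C Z VT" "r \<cdot> c = u" "k \<cdot> c = v"
          using product_pair[OF VT u v] by blast
        note jc' = Comp_in_hom[OF c(1) j(1)]
        have jv: "j \<cdot> c = \<gamma> \<cdot> v"
          using product_ext[OF V jc' Comp_in_hom[OF v \<gamma>(1)]] jc[OF c(1)] \<gamma>v[OF v] c(2,3) fv by simp
        then have "factors_through C (j \<cdot> c) \<gamma>"
          using factors_throughI[OF v jc' \<gamma>(1)] by simp
        then have "factors_through C (a \<cdot> (j \<cdot> c)) \<tau>"
          using aiff[OF jc'] by blast
        then have "factors_through C (b \<cdot> (j \<cdot> c)) \<tau>"
          using Comp_assoc[OF c(1) j(1) a] Comp_assoc[OF c(1) j(1) b] eq by simp
        then show "factors_through C v s"
          using biff[OF jc'] jv ft\<gamma>s[OF v] by simp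
      qed
    next
      assume R: ?R
      show "a \<cdot> j = b \<cdot> j"
      proof (rule classifier_ext[OF \<tau> Comp_in_hom[OF j(1) a] Comp_in_hom[OF j(1) b]])
        fix Z c assume c: "c \<in> hom_set C Z VT"
        note jc' = Comp_in_hom[OF c j(1)]
        have "factors_through C (j \<cdot> c) \<gamma> \<longleftrightarrow> factors_through C (j \<cdot> c) (\<gamma> \<cdot> s)"
        proof
          assume "factors_through C (j \<cdot> c) \<gamma>"
          then obtain v where v: "v \<in> hom_set C Z A" "\<gamma> \<cdot> v = j \<cdot> c"
            using factors_throughE jc' \<gamma>(1) by metis
          then have "f \<cdot> v = t \<cdot> (r \<cdot> c)"
            using \<gamma>v[OF v(1)] jc[OF c] by simp
          then have "factors_through C v s"
            using R v(1) Comp_in_hom[OF c rk(1)] by blast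
          then show "factors_through C (j \<cdot> c) (\<gamma> \<cdot> s)"
            using ft\<gamma>s[OF v(1)] v(2) by simp
        next
          have "factors_through C (\<gamma> \<cdot> s) \<gamma>"
            using factors_throughI[OF s(2) \<gamma>s \<gamma>(1)] by simp
          then show "factors_through C (j \<cdot> c) \<gamma>" if "factors_through C (j \<cdot> c) (\<gamma> \<cdot> s)"
            using factors_through_trans[OF that _ jc' \<gamma>s \<gamma>(1)] by blast
        qed
        then show "factors_through C (a \<cdot> j \<cdot> c) \<tau> \<longleftrightarrow> factors_through C (b \<cdot> j \<cdot> c) \<tau>"
          using aiff[OF jc'] biff[OF jc'] Comp_assoc[OF c j(1) a] Comp_assoc[OF c j(1) b] by simp
      qed
    qed
    then show ?thesis
      using eiff[OF VT t j] by blast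
  qed
  then show ?thesis
    using that e by blast
qed

section \<open>Complemented subobjects and their stability under pullback\<close>

text \<open>The lattice-theoretic definition only speaks of monomorphisms; here disjointness of \<open>m\<close> and
  \<open>n\<close> is tested on arbitrary generalized elements.\<close>

lemma complemented_subobjectE:
  assumes "complemented_subobject C X m"
  obtains n where "is_mono C m" "Cod C m = X" "is_mono C n" "Cod C n = X"
    "\<And>Z c s. \<lbrakk>c \<in> hom_set C Z X; factors_through C c m; factors_through C c n;
      is_mono C s; Cod C s = X\<rbrakk> \<Longrightarrow> factors_through C c s"
    "\<And>s. \<lbrakk>is_mono C s; Cod C s = X; factors_through C m s; factors_through C n s\<rbrakk>
      \<Longrightarrow> factors_through C (Id C X) s"
proof -
  have toX: "m \<in> hom_set C (Dom C m) X" if "is_mono C m" "Cod C m = X" for m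
    using mono_hom that by blast
  obtain n b t where m: "is_mono C m" "Cod C m = X" and n: "is_mono C n" "Cod C n = X"
    and b: "greatest (Sub C X) b (Lower (Sub C X) {m, n})" "least (Sub C X) b (carrier (Sub C X))"
    and t: "least (Sub C X) t (Upper (Sub C X) {m, n})" "greatest (Sub C X) t (carrier (Sub C X))"
    using assms by (auto simp: complemented_subobject_def Sub_def)
  have bX: "is_mono C b" "Cod C b = X" and tX: "is_mono C t" "Cod C t = X"
    using b(2) t(2) by (auto simp: least_def greatest_def Sub_def)
  have X: "X \<in> Ob C"
    using hom_Ob(2)[OF toX[OF m]] .
  note IX = Id_in_hom[OF X]
  have "factors_through C c s"
    if c: "c \<in> hom_set C Z X" and ft: "factors_through C c m" "factors_through C c n"
      and s: "is_mono C s" "Cod C s = X" for Z c s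
  proof -
    \<comment> \<open>\<open>m \<cdot> p\<close> is the intersection of \<open>m\<close> and
      \<open>n\<close>. It lies below \<open>b\<close>, hence below every \<open>s\<close>, and
      every element of both \<open>m\<close> and \<open>n\<close> factors through it.\<close>
    obtain P p q where P: "is_pullback C m n P p q"
      using pullback_ex toX[OF m] toX[OF n] by blast
    note pq = pullback_hom[OF P toX[OF m] toX[OF n]]
    note mp = Comp_in_hom[OF pq(1) toX[OF m]]
    have mono: "is_mono C (m \<cdot> p)"
      using mono_comp[OF m(1) toX[OF m] pullback_of_mono[OF P toX[OF m] toX[OF n] n(1)] pq(1)] .
    have "factors_through C (m \<cdot> p) m" "factors_through C (m \<cdot> p) n"
      using factors_throughI[OF pq(1) mp toX[OF m]] factors_throughI[OF pq(2) mp toX[OF n]] pq(3)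
      by auto
    then have "m \<cdot> p \<in> Lower (Sub C X) {m, n}"
      using mono mp by (auto simp: Lower_def Sub_def hom_set_def)
    then have mpb: "factors_through C (m \<cdot> p) b"
      using b(1) by (auto simp: greatest_def Sub_def)
    obtain x where x: "x \<in> hom_set C Z (Dom C m)" "m \<cdot> x = c"
      using factors_throughE[OF ft(1) c toX[OF m]] by blast
    obtain y where y: "y \<in> hom_set C Z (Dom C n)" "n \<cdot> y = c"
      using factors_throughE[OF ft(2) c toX[OF n]] by blast
    obtain h where h: "h \<in> hom_set C Z P" "p \<cdot> h = x"
      using pullback_pair[OF P toX[OF m] toX[OF n] x(1) y(1)] x(2) y(2) by metis
    have "m \<cdot> p \<cdot> h = c"
      using Comp_assoc[OF h(1) pq(1) toX[OF m]] h(2) x(2) by simp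
    then have cb: "factors_through C c b"
      using factors_through_comp[OF mpb mp toX[OF bX] h(1)] by simp
    have "factors_through C b s"
      using b(2) s by (auto simp: least_def Sub_def)
    then show ?thesis
      using factors_through_trans[OF cb _ c toX[OF bX] toX[OF s]] by blast
  qed
  moreover have "factors_through C (Id C X) s"
    if s: "is_mono C s" "Cod C s = X" and ft: "factors_through C m s" "factors_through C n s" for s
  proof -
    have "s \<in> Upper (Sub C X) {m, n}"
      using s ft by (auto simp: Upper_def Sub_def)
    then have ts: "factors_through C t s"
      using t(1) by (auto simp: least_def Sub_def)
    \<comment> \<open>The join \<open>t\<close> is also the largest subobject, so it lies above the
      identity.\<close>
    have "factors_through C (Id C X) t"
      using t(2) mono_Id[OF X] IX by (auto simp: greatest_def Sub_def hom_set_def)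
    then show ?thesis
      using factors_through_trans[OF _ ts IX toX[OF tX] toX[OF s]] by blast
  qed
  ultimately show ?thesis
    using that m n by blast
qed

text \<open>The intersection of \<open>m\<close> and \<open>n\<close> is a pullback, and
  \<open>disj\<close> places it below every subobject, so it serves as meet and bottom. By
  \<open>cover\<close> the identity serves as join and top.\<close>

lemma complemented_subobjectI:
  assumes m: "is_mono C m" "Cod C m = X" and n: "is_mono C n" "Cod C n = X"
    and disj: "\<And>Z c s. \<lbrakk>c \<in> hom_set C Z X; factors_through C c m; factors_through C c n;
      is_mono C s; Cod C s = X\<rbrakk> \<Longrightarrow> factors_through C c s"
    and cover: "\<And>s. \<lbrakk>is_mono C s; Cod C s = X; factors_through C m s; factors_through C n s\<rbrakk>
      \<Longrightarrow> factors_through C (Id C X) s"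
  shows "complemented_subobject C X m"
proof -
  have toX: "m \<in> hom_set C (Dom C m) X" if "is_mono C m" "Cod C m = X" for m
    using mono_hom that by blast
  have X: "X \<in> Ob C"
    using hom_Ob(2)[OF toX[OF m]] .
  note IX = Id_in_hom[OF X]
  obtain P p q where P: "is_pullback C m n P p q"
    using pullback_ex toX[OF m] toX[OF n] by blast
  note pq = pullback_hom[OF P toX[OF m] toX[OF n]]
  note mp = Comp_in_hom[OF pq(1) toX[OF m]]
  have mono: "is_mono C (m \<cdot> p)" "Cod C (m \<cdot> p) = X"
    using mono_comp[OF m(1) toX[OF m] pullback_of_mono[OF P toX[OF m] toX[OF n] n(1)] pq(1)] mp
    by (auto simp: hom_set_def)
  have ft: "factors_through C (m \<cdot> p) m" "factors_through C (m \<cdot> p) n"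
    using factors_throughI[OF pq(1) mp toX[OF m]] factors_throughI[OF pq(2) mp toX[OF n]] pq(3)
    by auto
  have I: "is_mono C (Id C X)" "Cod C (Id C X) = X"
    using mono_Id[OF X] IX by (auto simp: hom_set_def)
  have top: "factors_through C s (Id C X)" if "is_mono C s" "Cod C s = X" for s
    using factors_throughI[OF toX[OF that] toX[OF that] IX Id_Comp[OF toX[OF that]]] .
  have bot: "factors_through C (m \<cdot> p) s" if "is_mono C s" "Cod C s = X" for s
    using disj[OF mp ft that] .
  have "greatest (Sub C X) (m \<cdot> p) (Lower (Sub C X) {m, n})"
    using ft mono disj[OF toX _ _ mono] by (auto simp: greatest_def Lower_def Sub_def m n)
  moreover have "least (Sub C X) (m \<cdot> p) (carrier (Sub C X))"
    using bot mono by (auto simp: least_def Sub_def)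
  moreover have "greatest (Sub C X) (Id C X) (carrier (Sub C X))"
    using top I by (auto simp: greatest_def Sub_def)
  moreover have "least (Sub C X) (Id C X) (Upper (Sub C X) {m, n})"
    using top I m n cover by (auto simp: least_def Upper_def Sub_def)
  ultimately show ?thesis
    using m n unfolding complemented_subobject_def by (auto simp: Sub_def)
qed

text \<open>The pullback \<open>n'\<close> of the complement is the new complement. To test
  disjointness and covering on \<open>A\<close> against \<open>s\<close>, the universal image
  \<open>e\<close> of \<open>s\<close> along \<open>f\<close> is used: a subobject of
  \<open>B\<close> lies below \<open>e\<close> exactly when its inverse image lies below
  \<open>s\<close>, so both properties transfer from \<open>B\<close>.\<close>

lemma complemented_subobject_pullback:
  assumes P: "is_pullback C f m P m' u" and f: "f \<in> hom_set C A B"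
    and m: "complemented_subobject C B m"
  shows "complemented_subobject C A m'"
proof -
  note AB = hom_Ob[OF f]
  obtain n where mB: "is_mono C m" "Cod C m = B" and nB: "is_mono C n" "Cod C n = B"
    and disj: "\<And>Z c s. \<lbrakk>c \<in> hom_set C Z B; factors_through C c m; factors_through C c n;
        is_mono C s; Cod C s = B\<rbrakk> \<Longrightarrow> factors_through C c s"
    and cover: "\<And>s. \<lbrakk>is_mono C s; Cod C s = B; factors_through C m s; factors_through C n s\<rbrakk>
        \<Longrightarrow> factors_through C (Id C B) s"
    using complemented_subobjectE[OF m] by metis
  have mh: "m \<in> hom_set C (Dom C m) B" and nh: "n \<in> hom_set C (Dom C n) B"
    using mono_hom[OF mB(1)] mono_hom[OF nB(1)] mB nB by auto
  obtain Q n' w where Q: "is_pullback C f n Q n' w"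
    using pullback_ex f nh by blast
  note mP = pullback_hom[OF P f mh] and nQ = pullback_hom[OF Q f nh]
  note mfac = pullback_factors_through_iff[OF P f mh] and nfac = pullback_factors_through_iff[OF Q f nh]
  have m': "is_mono C m'" "Cod C m' = A" and n': "is_mono C n'" "Cod C n' = A"
    using pullback_of_mono[OF P f mh mB(1)] pullback_of_mono[OF Q f nh nB(1)] mP nQ
    by (auto simp: hom_set_def)
  show ?thesis
  proof (rule complemented_subobjectI[OF m' n'])
    fix Z c s
    assume c: "c \<in> hom_set C Z A" and ft: "factors_through C c m'" "factors_through C c n'"
      and s: "is_mono C s" "Cod C s = A"
    have sA: "s \<in> hom_set C (Dom C s) A"
      using mono_hom[OF s(1)] s(2) by simp
    obtain e where e: "is_mono C e" "Cod C e = B"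
      and eiff: "\<And>T t. t \<in> hom_set C T B \<Longrightarrow> factors_through C t e \<longleftrightarrow>
        (\<forall>Z. \<forall>u \<in> hom_set C Z T. \<forall>v \<in> hom_set C Z A. f \<cdot> v = t \<cdot> u \<longrightarrow> factors_through C v s)"
      using universal_image[OF f s(1) sA] by blast
    note fc = Comp_in_hom[OF c f]
    have "factors_through C (f \<cdot> c) e"
      using disj[OF fc _ _ e] mfac[OF c] nfac[OF c] ft by blast
    \<comment> \<open>Membership of \<open>f \<cdot> c\<close> in \<open>e\<close> is evaluated at
      \<open>u\<close> the identity and \<open>v = c\<close>.\<close>
    then show "factors_through C c s"
      using eiff[OF fc] Id_in_hom[OF hom_Ob(1)[OF c]] c Comp_Id[OF fc] by metis
  next
    fix s
    assume s: "is_mono C s" "Cod C s = A" and ft: "factors_through C m' s" "factors_through C n' s"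
    have sA: "s \<in> hom_set C (Dom C s) A"
      using mono_hom[OF s(1)] s(2) by simp
    obtain e where e: "is_mono C e" "Cod C e = B"
      and eiff: "\<And>T t. t \<in> hom_set C T B \<Longrightarrow> factors_through C t e \<longleftrightarrow>
        (\<forall>Z. \<forall>u \<in> hom_set C Z T. \<forall>v \<in> hom_set C Z A. f \<cdot> v = t \<cdot> u \<longrightarrow> factors_through C v s)"
      using universal_image[OF f s(1) sA] by blast
    have "factors_through C m e"
      unfolding eiff[OF mh]
    proof (intro allI ballI impI)
      fix Z u v assume u: "u \<in> hom_set C Z (Dom C m)" and v: "v \<in> hom_set C Z A" and eq: "f \<cdot> v = m \<cdot> u"
      have "factors_through C v m'"
        using mfac[OF v] factors_throughI[OF u Comp_in_hom[OF v f] mh] eq by simp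
      then show "factors_through C v s"
        using factors_through_trans[OF _ ft(1) v mP(1) sA] by blast
    qed
    moreover have "factors_through C n e"
      unfolding eiff[OF nh]
    proof (intro allI ballI impI)
      fix Z u v assume u: "u \<in> hom_set C Z (Dom C n)" and v: "v \<in> hom_set C Z A" and eq: "f \<cdot> v = n \<cdot> u"
      have "factors_through C v n'"
        using nfac[OF v] factors_throughI[OF u Comp_in_hom[OF v f] nh] eq by simp
      then show "factors_through C v s"
        using factors_through_trans[OF _ ft(2) v nQ(1) sA] by blast
    qed
    ultimately have "factors_through C (Id C B) e"
      using cover e by blast
    moreover have "f \<cdot> Id C A = Id C B \<cdot> f"
      using Comp_Id[OF f] Id_Comp[OF f] by simp
    ultimately show "factors_through C (Id C A) s"
      using eiff[OF Id_in_hom[OF AB(2)]] f Id_in_hom[OF AB(1)] by blast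
  qed
qed

section \<open>Subobjects of decidable objects\<close>

text \<open>Because \<open>m\<close> is monic, the diagonal of \<open>X\<close> is the pullback of
  the diagonal of \<open>Y\<close> along \<open>m \<times> m\<close>, and complements are stable
  under pullback.\<close>

lemma decidable_mono:
  assumes m: "is_mono C m" "m \<in> hom_set C X Y" and Y: "decidable C Y"
  shows "decidable C X"
proof -
  note X = hom_Ob(1)[OF m(2)]
  note I = Id_in_hom[OF X]
  obtain Q p q d where Q: "is_product C Y Y Q p q" and d: "d \<in> hom_set C Y Q"
    "p \<cdot> d = Id C Y" "q \<cdot> d = Id C Y" "complemented_subobject C Q d"
    using Y by (auto simp: decidable_def)
  note pq = product_hom[OF Q]
  obtain P r s where P: "is_product C X X P r s"
    using product_ex X by blast
  note rs = product_hom[OF P]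
  obtain d' where d': "d' \<in> hom_set C X P" "r \<cdot> d' = Id C X" "s \<cdot> d' = Id C X"
    using product_pair[OF P I I] by blast
  note mr = Comp_in_hom[OF rs(1) m(2)] and ms = Comp_in_hom[OF rs(2) m(2)]
  \<comment> \<open>\<open>w\<close> is \<open>m \<times> m\<close>.\<close>
  obtain w where w: "w \<in> hom_set C P Q" "p \<cdot> w = m \<cdot> r" "q \<cdot> w = m \<cdot> s"
    using product_pair[OF Q mr ms] by blast
  have wc: "p \<cdot> (w \<cdot> c) = m \<cdot> (r \<cdot> c)" "q \<cdot> (w \<cdot> c) = m \<cdot> (s \<cdot> c)" if "c \<in> hom_set C Z P" for Z c
    using Comp_assoc[OF that w(1) pq(1)] Comp_assoc[OF that w(1) pq(2)] w
      Comp_assoc[OF that rs(1) m(2)] Comp_assoc[OF that rs(2) m(2)] by simp_all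
  have dc: "p \<cdot> (d \<cdot> c) = c" "q \<cdot> (d \<cdot> c) = c" if "c \<in> hom_set C Z Y" for Z c
    using Comp_assoc[OF that d(1) pq(1)] Comp_assoc[OF that d(1) pq(2)] d Id_Comp[OF that] by simp_all
  have dc': "r \<cdot> (d' \<cdot> c) = c" "s \<cdot> (d' \<cdot> c) = c" if "c \<in> hom_set C Z X" for Z c
    using Comp_assoc[OF that d'(1) rs(1)] Comp_assoc[OF that d'(1) rs(2)] d' Id_Comp[OF that] by simp_all
  have eq: "w \<cdot> d' = d \<cdot> m"
    using product_ext[OF Q Comp_in_hom[OF d'(1) w(1)] Comp_in_hom[OF m(2) d(1)]]
      wc[OF d'(1)] dc[OF m(2)] d' Comp_Id[OF m(2)] by simp
  have "\<exists>!h. h \<in> hom_set C Z X \<and> d' \<cdot> h = a \<and> m \<cdot> h = b"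
    if a: "a \<in> hom_set C Z P" and b: "b \<in> hom_set C Z Y" and ab: "w \<cdot> a = d \<cdot> b" for Z a b
  proof -
    note ra = Comp_in_hom[OF a rs(1)] and sa = Comp_in_hom[OF a rs(2)]
    have rb: "m \<cdot> (r \<cdot> a) = b" and sb: "m \<cdot> (s \<cdot> a) = b"
      using wc[OF a] dc[OF b] ab by simp_all
    \<comment> \<open>Both components of \<open>a\<close> are sent to \<open>b\<close> by the monic
      \<open>m\<close>, so \<open>a\<close> lies on the diagonal of \<open>X\<close>.\<close>
    then have "r \<cdot> a = s \<cdot> a"
      using mono_cancel[OF m ra sa] by simp
    then have "d' \<cdot> (r \<cdot> a) = a"
      using product_ext[OF P Comp_in_hom[OF ra d'(1)] a] dc'[OF ra] by simp
    then show ?thesis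
      using rb ra dc' by metis
  qed
  then have "is_pullback C w d X d' m"
    by (rule pullbackI[OF w(1) d(1) d'(1) m(2) eq])
  then have "complemented_subobject C P d'"
    using complemented_subobject_pullback w(1) d(4) by blast
  then show ?thesis
    using X P d' unfolding decidable_def by blast
qed

section \<open>Global points, (NS) and exponentials of decidable objects\<close>

text \<open>A global point below every subobject makes the topos degenerate.\<close>

lemma point_in_all_subobjects:
  assumes T: "is_terminal C T" and c: "c \<in> hom_set C T V"
    and all: "\<And>s. \<lbrakk>is_mono C s; Cod C s = V\<rbrakk> \<Longrightarrow> factors_through C c s"
    and s: "is_mono C s" "Cod C s = V"
  shows "factors_through C (Id C V) s"
proof -
  have TO: "T \<in> Ob C" and V: "V \<in> Ob C"
    using hom_Ob[OF c] by auto
  have sV: "s \<in> hom_set C (Dom C s) V"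
    using mono_hom[OF s(1)] s(2) by simp
  obtain f where f: "f \<in> hom_set C V T"
    using terminal_hom[OF T V] by blast
  \<comment> \<open>\<open>e\<close> is the truth value of the statement that \<open>s\<close> is
    all of \<open>V\<close>, as a subobject of the terminal object.\<close>
  obtain e where e: "is_mono C e" "Cod C e = T"
    and eiff: "\<And>S t. t \<in> hom_set C S T \<Longrightarrow> factors_through C t e \<longleftrightarrow>
        (\<forall>Z. \<forall>u \<in> hom_set C Z S. \<forall>v \<in> hom_set C Z V. f \<cdot> v = t \<cdot> u \<longrightarrow> factors_through C v s)"
    using universal_image[OF f s(1) sV] by blast
  have eh: "e \<in> hom_set C (Dom C e) T"
    using mono_hom[OF e(1)] e(2) by simp
  note ce = Comp_in_hom[OF eh c]
  \<comment> \<open>As \<open>c\<close> lies below every subobject of \<open>V\<close>, it factors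
    through \<open>c \<cdot> e\<close>. The factor is a global point of the domain of
    \<open>e\<close>, which forces \<open>e\<close> to be all of \<open>T\<close>.\<close>
  have "is_mono C (c \<cdot> e)" "Cod C (c \<cdot> e) = V"
    using mono_comp[OF terminal_mono[OF T c] c e(1) eh] ce by (auto simp: hom_set_def)
  then have "factors_through C c (c \<cdot> e)"
    by (rule all)
  then obtain h where h: "h \<in> hom_set C T (Dom C e)"
    using factors_throughE[OF _ c ce] by blast
  have "factors_through C (Id C T) e"
    using factors_throughI[OF h Id_in_hom[OF TO] eh]
      terminal_ext[OF T Comp_in_hom[OF h eh] Id_in_hom[OF TO]] by blast
  moreover have "f \<cdot> Id C V = Id C T \<cdot> f"
    using Comp_Id[OF f] Id_Comp[OF f] by simp
  ultimately show ?thesis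
    using eiff[OF Id_in_hom[OF TO]] f Id_in_hom[OF V] by blast
qed

text \<open>The locus \<open>m\<close> where \<open>a\<close> and \<open>b\<close> agree is a
  pullback of the diagonal of \<open>Y\<close>, so it has a complement \<open>n\<close>. By (NS) the
  domain of \<open>n\<close> is initial, and then \<open>m\<close> covers \<open>V\<close>, or it
  has a global point, which by \<open>points\<close> also lies in \<open>m\<close>.\<close>

lemma NS_points_separate:
  assumes NS: "NS C" and Y: "decidable C Y" and a: "a \<in> hom_set C V Y" and b: "b \<in> hom_set C V Y"
    and points: "\<And>T c. \<lbrakk>is_terminal C T; c \<in> hom_set C T V\<rbrakk> \<Longrightarrow> a \<cdot> c = b \<cdot> c"
  shows "a = b"
proof -
  note V = hom_Ob(1)[OF a]
  obtain Q p q d where Q: "is_product C Y Y Q p q" and d: "d \<in> hom_set C Y Q"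
    "p \<cdot> d = Id C Y" "q \<cdot> d = Id C Y" "complemented_subobject C Q d"
    using Y by (auto simp: decidable_def)
  note pq = product_hom[OF Q]
  obtain w where w: "w \<in> hom_set C V Q" "p \<cdot> w = a" "q \<cdot> w = b"
    using product_pair[OF Q a b] by blast
  \<comment> \<open>\<open>m\<close> is the pullback of the diagonal along the pairing of
    \<open>a\<close> and \<open>b\<close>.\<close>
  obtain P m u where P: "is_pullback C w d P m u"
    using pullback_ex w(1) d(1) by blast
  note mu = pullback_hom[OF P w(1) d(1)]
  have fac: "factors_through C c m \<longleftrightarrow> a \<cdot> c = b \<cdot> c" if c: "c \<in> hom_set C Z V" for Z c
  proof -
    note wc = Comp_in_hom[OF c w(1)]
    have pw: "p \<cdot> (w \<cdot> c) = a \<cdot> c" "q \<cdot> (w \<cdot> c) = b \<cdot> c"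
      using Comp_assoc[OF c w(1) pq(1)] Comp_assoc[OF c w(1) pq(2)] w by simp_all
    have dx: "p \<cdot> (d \<cdot> x) = x" "q \<cdot> (d \<cdot> x) = x" if "x \<in> hom_set C Z Y" for x
      using Comp_assoc[OF that d(1) pq(1)] Comp_assoc[OF that d(1) pq(2)] d Id_Comp[OF that] by simp_all
    have "factors_through C (w \<cdot> c) d \<longleftrightarrow> a \<cdot> c = b \<cdot> c"
    proof
      assume "factors_through C (w \<cdot> c) d"
      then show "a \<cdot> c = b \<cdot> c"
        using factors_throughE[OF _ wc d(1)] dx pw by metis
    next
      assume eq: "a \<cdot> c = b \<cdot> c"
      note ac = Comp_in_hom[OF c a]
      have "d \<cdot> (a \<cdot> c) = w \<cdot> c"
        using product_ext[OF Q Comp_in_hom[OF ac d(1)] wc] dx[OF ac] pw eq by simp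
      then show "factors_through C (w \<cdot> c) d"
        using factors_throughI[OF ac wc d(1)] by blast
    qed
    then show ?thesis
      using pullback_factors_through_iff[OF P w(1) d(1) c] by blast
  qed
  obtain n where m: "is_mono C m" "Cod C m = V" and n: "is_mono C n" "Cod C n = V"
    and disj: "\<And>Z c s. \<lbrakk>c \<in> hom_set C Z V; factors_through C c m; factors_through C c n;
        is_mono C s; Cod C s = V\<rbrakk> \<Longrightarrow> factors_through C c s"
    and cover: "\<And>s. \<lbrakk>is_mono C s; Cod C s = V; factors_through C m s; factors_through C n s\<rbrakk>
        \<Longrightarrow> factors_through C (Id C V) s"
    using complemented_subobjectE[OF complemented_subobject_pullback[OF P w(1) d(4)]] by metis
  have nh: "n \<in> hom_set C (Dom C n) V"
    using mono_hom[OF n(1)] n(2) by simp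
  have "factors_through C (Id C V) m"
  proof (cases "is_initial C (Dom C n)")
    case True
    then have "a \<cdot> n = b \<cdot> n"
      using Comp_in_hom[OF nh a] Comp_in_hom[OF nh b] hom_Ob(2)[OF a] unfolding is_initial_def by blast
    then have "factors_through C n m"
      using fac[OF nh] by blast
    moreover have "factors_through C m m"
      using factors_throughI[OF Id_in_hom[OF hom_Ob(1)[OF mu(1)]] mu(1) mu(1) Comp_Id[OF mu(1)]] .
    ultimately show ?thesis
      using cover m by blast
  next
    case False
    then obtain T k where T: "is_terminal C T" and k: "k \<in> hom_set C T (Dom C n)"
      using NS hom_Ob(1)[OF nh] unfolding NS_def by blast
    note nk = Comp_in_hom[OF k nh]
    have "factors_through C (n \<cdot> k) m"
      using fac[OF nk] points[OF T nk] by blast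
    moreover have "factors_through C (n \<cdot> k) n"
      using factors_throughI[OF k nk nh] by blast
    \<comment> \<open>A point in both \<open>m\<close> and its complement lies in every subobject of
      \<open>V\<close>, so the topos is degenerate and \<open>m\<close> is everything.\<close>
    ultimately show ?thesis
      using point_in_all_subobjects[OF T nk _ m] disj[OF nk] by blast
  qed
  then show "a = b"
    using fac[OF Id_in_hom[OF V]] Comp_Id[OF a] Comp_Id[OF b] by simp
qed

text \<open>Evaluation at a point of \<open>X\<close> is an arrow from \<open>P\<close> to
  \<open>Y\<close>, so by \<open>ext\<close> it factors through \<open>\<eta>\<close>. Hence the
  uncurried \<open>f\<close> and \<open>g\<close> agree at all points once
  \<open>\<eta> \<cdot> f = \<eta> \<cdot> g\<close>, and \<open>NS_points_separate\<close> makes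
  them equal.\<close>

lemma exponential_mono:
  assumes NS: "NS C" and Y: "decidable C Y" and X: "is_exponential C X Y P W p q ev"
    and \<eta>: "\<eta> \<in> hom_set C P Q" and ext: "\<And>g. g \<in> hom_set C P Y \<Longrightarrow> \<exists>h \<in> hom_set C Q Y. g = h \<cdot> \<eta>"
  shows "is_mono C \<eta>"
proof (rule monoI[OF \<eta>])
  fix Z f g assume f: "f \<in> hom_set C Z P" and g: "g \<in> hom_set C Z P" and eq: "\<eta> \<cdot> f = \<eta> \<cdot> g"
  have W: "is_product C P X W p q" and ev: "ev \<in> hom_set C W Y"
    using X by (auto simp: is_exponential_def)
  note pq = product_hom[OF W]
  obtain V r s where V: "is_product C Z X V r s"
    using product_ex hom_Ob(1)[OF f] hom_Ob(2)[OF pq(2)] by blast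
  note rs = product_hom[OF V]
  \<comment> \<open>\<open>F\<close> and \<open>G\<close> are \<open>f \<times> X\<close> and
    \<open>g \<times> X\<close>, so \<open>ev \<cdot> F\<close> and \<open>ev \<cdot> G\<close> are
    the uncurried \<open>f\<close> and \<open>g\<close>.\<close>
  obtain F where F: "F \<in> hom_set C V W" "p \<cdot> F = f \<cdot> r" "q \<cdot> F = s"
    using product_pair[OF W Comp_in_hom[OF rs(1) f] rs(2)] by blast
  obtain G where G: "G \<in> hom_set C V W" "p \<cdot> G = g \<cdot> r" "q \<cdot> G = s"
    using product_pair[OF W Comp_in_hom[OF rs(1) g] rs(2)] by blast
  note evF = Comp_in_hom[OF F(1) ev] and evG = Comp_in_hom[OF G(1) ev]
  have "ev \<cdot> F = ev \<cdot> G"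
  proof (rule NS_points_separate[OF NS Y evF evG])
    fix T c assume T: "is_terminal C T" and c: "c \<in> hom_set C T V"
    note rc = Comp_in_hom[OF c rs(1)] and sc = Comp_in_hom[OF c rs(2)]
    obtain t where t: "t \<in> hom_set C P T"
      using terminal_hom[OF T hom_Ob(1)[OF \<eta>]] by blast
    note sct = Comp_in_hom[OF t sc] and I = Id_in_hom[OF hom_Ob(1)[OF \<eta>]]
    \<comment> \<open>\<open>j\<close> pairs the identity of \<open>P\<close> with the constant
      arrow at the point \<open>s \<cdot> c\<close> of \<open>X\<close>, so
      \<open>ev \<cdot> j\<close> is evaluation at that point.\<close>
    obtain j where j: "j \<in> hom_set C P W" "p \<cdot> j = Id C P" "q \<cdot> j = s \<cdot> c \<cdot> t"
      using product_pair[OF W I sct] by blast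
    obtain h where h: "h \<in> hom_set C Q Y" "ev \<cdot> j = h \<cdot> \<eta>"
      using ext[OF Comp_in_hom[OF j(1) ev]] by blast
    \<comment> \<open>The value at \<open>c\<close> of the uncurried \<open>k\<close> depends on
      \<open>k\<close> only through \<open>\<eta> \<cdot> k\<close>. The claim is applied to
      \<open>f\<close> with \<open>F\<close> and to \<open>g\<close> with \<open>G\<close>.\<close>
    have key: "ev \<cdot> K \<cdot> c = h \<cdot> (\<eta> \<cdot> k \<cdot> (r \<cdot> c))"
      if k: "k \<in> hom_set C Z P" and K: "K \<in> hom_set C V W" "p \<cdot> K = k \<cdot> r" "q \<cdot> K = s" for k K
    proof -
      note x = Comp_in_hom[OF rc k]
      have "t \<cdot> (k \<cdot> (r \<cdot> c)) = Id C T"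
        using terminal_ext[OF T Comp_in_hom[OF x t] Id_in_hom[OF hom_Ob(1)[OF c]]] .
      then have "s \<cdot> c \<cdot> t \<cdot> (k \<cdot> (r \<cdot> c)) = s \<cdot> c"
        using Comp_assoc[OF x t sc] Comp_Id[OF sc] by simp
      then have "K \<cdot> c = j \<cdot> (k \<cdot> (r \<cdot> c))"
        using product_ext[OF W Comp_in_hom[OF c K(1)] Comp_in_hom[OF x j(1)]]
          Comp_assoc[OF c K(1) pq(1)] Comp_assoc[OF c K(1) pq(2)] K
          Comp_assoc[OF x j(1) pq(1)] Comp_assoc[OF x j(1) pq(2)] j
          Comp_assoc[OF c rs(1) k] Id_Comp[OF x] by simp
      then show ?thesis
        using Comp_assoc[OF c K(1) ev] Comp_assoc[OF x j(1) ev] h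
          Comp_assoc[OF x \<eta> h(1)] Comp_assoc[OF rc k \<eta>] by simp
    qed
    show "ev \<cdot> F \<cdot> c = ev \<cdot> G \<cdot> c"
      using key[OF f F] key[OF g G] eq by simp
  qed
  \<comment> \<open>Both \<open>f\<close> and \<open>g\<close> are transposes of the common arrow
    \<open>ev \<cdot> F\<close>, so uniqueness identifies them.\<close>
  moreover have "\<exists>!h. h \<in> hom_set C Z P \<and>
      (\<exists>g \<in> hom_set C V W. p \<cdot> g = h \<cdot> r \<and> q \<cdot> g = s \<and> ev \<cdot> g = ev \<cdot> F)"
    using X V evF unfolding is_exponential_def by blast
  ultimately show "f = g"
    using f g F G by metis
qed

end

section \<open>The unit of the reflection and the conclusion\<close>

text \<open>The unit \<open>\<eta>\<close> corresponds to the identity of the reflected object under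
  the adjunction bijection. Surjectivity of the bijection supplies \<open>h\<close>, and naturality
  in the codomain gives the factorization.\<close>

lemma reflective_unit:
  assumes C: "category C" and refl: "reflective C (full_subcategory C S)" and X: "X \<in> Ob C"
  obtains Q \<eta> where "Q \<in> S" "\<eta> \<in> hom_set C X Q"
    "\<And>Y g. \<lbrakk>Y \<in> S; g \<in> hom_set C X Y\<rbrakk> \<Longrightarrow> \<exists>h \<in> hom_set C Q Y. g = h \<cdot>\<^bsub>C\<^esub> \<eta>"
proof -
  interpret category C by (rule C)
  let ?D = "full_subcategory C S"
  have Ob_D: "Ob ?D = Ob C \<inter> S" and Id_D: "Id ?D = Id C" and Comp_D: "Comp ?D = Comp C"
    by (simp_all add: full_subcategory_def)
  have hom_D: "hom_set ?D Y Z = hom_set C Y Z" if "Y \<in> S" "Z \<in> S" for Y Z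
    using that by (auto simp: full_subcategory_def hom_set_def)
  obtain L \<phi> where L: "is_functor C ?D L"
    and bij: "\<forall>X \<in> Ob C. \<forall>Y \<in> Ob ?D.
      bij_betw (\<phi> X Y) (hom_set ?D (omap L X) Y) (hom_set C X Y)"
    and nat: "\<forall>X \<in> Ob C. \<forall>X' \<in> Ob C. \<forall>Y \<in> Ob ?D. \<forall>Y' \<in> Ob ?D. \<forall>f \<in> hom_set C X' X.
      \<forall>g \<in> hom_set ?D Y Y'. \<forall>h \<in> hom_set ?D (omap L X) Y.
        \<phi> X' Y' (g \<cdot>\<^bsub>C\<^esub> h \<cdot>\<^bsub>C\<^esub> amap L f) = g \<cdot>\<^bsub>C\<^esub> \<phi> X Y h \<cdot>\<^bsub>C\<^esub> f"
    using refl unfolding reflective_def is_left_adjoint_def inclusion_def Comp_D func.simps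
    by (elim exE conjE) (rule that)
  let ?Q = "omap L X"
  have Q: "?Q \<in> Ob C" "?Q \<in> S" and LI: "amap L (Id C X) = Id C ?Q"
    using L X by (auto simp: is_functor_def Ob_D Id_D)
  have IQ: "Id C ?Q \<in> hom_set ?D ?Q ?Q"
    using Id_in_hom[OF Q(1)] hom_D Q(2) by simp
  define \<eta> where "\<eta> = \<phi> X ?Q (Id C ?Q)"
  have \<eta>: "\<eta> \<in> hom_set C X ?Q"
    using bij X Q IQ bij_betwE unfolding \<eta>_def Ob_D by blast
  have "\<exists>h \<in> hom_set C ?Q Y. g = h \<cdot>\<^bsub>C\<^esub> \<eta>" if Y: "Y \<in> S" and g: "g \<in> hom_set C X Y" for Y g
  proof -
    have YD: "Y \<in> Ob ?D"
      using Y hom_Ob(2)[OF g] by (simp add: Ob_D)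
    have QD: "?Q \<in> Ob ?D"
      using Q by (simp add: Ob_D)
    obtain h where hD: "h \<in> hom_set ?D ?Q Y" and gh: "g = \<phi> X Y h"
      using bij X YD g unfolding bij_betw_def by blast
    have h: "h \<in> hom_set C ?Q Y"
      using hD hom_D Q(2) Y by simp
    \<comment> \<open>Naturality is taken at the identity of \<open>?Q\<close>, with
      \<open>h\<close> as the arrow out of \<open>?Q\<close> and the identity of \<open>X\<close> on
      the other side.\<close>
    have "\<phi> X Y (h \<cdot>\<^bsub>C\<^esub> Id C ?Q \<cdot>\<^bsub>C\<^esub> amap L (Id C X)) = h \<cdot>\<^bsub>C\<^esub> \<eta> \<cdot>\<^bsub>C\<^esub> Id C X"
      using nat X QD YD Id_in_hom[OF X] hD IQ unfolding \<eta>_def by blast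
    then have "g = h \<cdot>\<^bsub>C\<^esub> \<eta> \<cdot>\<^bsub>C\<^esub> Id C X"
      using gh LI Comp_Id[OF h] by simp
    then show ?thesis
      using h Comp_Id[OF Comp_in_hom[OF \<eta> h]] by auto
  qed
  then show ?thesis
    using that Q(2) \<eta> by blast
qed

theorem theoremB:
  fixes E :: "('o, 'a) cat"
  assumes "elementary_topos E"
    and "NS E"
    and "reflective E (Dec E)"
  shows "exponential_ideal E (Dec E)"
proof -
  interpret elementary_topos E by (rule assms(1))
  have Ob_Dec: "Y \<in> Ob (Dec E) \<longleftrightarrow> decidable E Y" for Y
    by (auto simp: Dec_def full_subcategory_def decidable_def)
  have "decidable E P"
    if Y: "decidable E Y" and X: "is_exponential E X Y P W p q ev" for X Y P W p q ev
  proof -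
    have P: "P \<in> Ob E"
      using X by (auto simp: is_exponential_def is_product_def)
    obtain Q \<eta> where Q: "decidable E Q" and \<eta>: "\<eta> \<in> hom_set E P Q"
      and ext: "\<And>Y g. \<lbrakk>decidable E Y; g \<in> hom_set E P Y\<rbrakk> \<Longrightarrow> \<exists>h \<in> hom_set E Q Y. g = h \<cdot>\<^bsub>E\<^esub> \<eta>"
      using reflective_unit[OF category_axioms assms(3)[unfolded Dec_def] P, unfolded mem_Collect_eq]
      by metis
    have "is_mono E \<eta>"
      by (rule exponential_mono[OF assms(2) Y X \<eta> ext[OF Y]])
    then show ?thesis
      by (rule decidable_mono[OF _ \<eta> Q])
  qed
  then show ?thesis
    by (auto simp: exponential_ideal_def Ob_Dec)
qed

end
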